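(* As $n\to\infty$, $$\frac{\tilde{F}_n}{n!}=\frac{1}{2e\,(\log 2)^{n+1}}+O\!\left((6.3213)^{-n}\right).$$
   Context: For $n\ge 0$ let $[n]=\{1,\dots,n\}$. A partition of $[n]$ into $k$ blocks is written $B_1|B_2|\cdots|B_k$, with non-empty disjoint blocks whose union is $[n]$, listed so that $\min B_1<\min B_2<\cdots<\min B_k$. A deranged partition of $[n]$ is an arrangement $B_{\sigma(1)}|B_{\sigma(2)}|\cdots|B_{\sigma(k)}$ of the blocks of some partition $B_1|\cdots|B_k$ of $[n]$, where $\sigma$ is a permutation of $[k]$ such that $B_{\sigma(i)}\neq B_i$ for all $1\le i\le k$ (i.e. $\sigma$ is a derangement). The deranged Bell number $\tilde{F}_n$ is the total number of deranged partitions of $[n]$ (over all $k$), with $\tilde{F}_0=1$. Here $\log$ is the natural logarithm. *)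

theory Defs
  imports Complex_Main "HOL-Library.Disjoint_Sets" "HOL-Library.Landau_Symbols"
    "HOL-Combinatorics.Permutations"
begin

definition standard_partition :: "nat \<Rightarrow> nat set list \<Rightarrow> bool" where
  "standard_partition n Bs \<longleftrightarrow>
     partition_on {1..n} (set Bs) \<and> sorted_wrt (\<lambda>A B. Min A < Min B) Bs"

text \<open>
  Block positions are 0-based, so a permutation of the block indices permutes \<open>{..<k}\<close>;
  \<open>permute_list \<sigma> Bs\<close> has \<open>Bs ! \<sigma> i\<close> at position \<open>i\<close>.
\<close>
definition deranged_partitions :: "nat \<Rightarrow> nat set list set" where
  "deranged_partitions n =
     {permute_list \<sigma> Bs | \<sigma> Bs.
        standard_partition n Bs \<and> \<sigma> permutes {..<length Bs} \<and>
        (\<forall>i<length Bs. Bs ! \<sigma> i \<noteq> Bs ! i)}"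

text \<open>The convention that the value at \<open>0\<close> is \<open>1\<close> is automatic: the empty list is the only
  deranged partition of the empty set.\<close>
definition deranged_bell :: "nat \<Rightarrow> nat" where
  "deranged_bell n = card (deranged_partitions n)"

end

theory Submission
  imports Defs "HOL-Combinatorics.Stirling" "HOL-Complex_Analysis.Complex_Analysis"
begin

text \<open>
  A deranged partition of \<open>{1..n}\<close> is a set partition together with a derangement of its blocks, so
  the deranged Bell number is the sum over \<open>k\<close> of the Stirling number of \<open>n\<close> and \<open>k\<close> times the number
  of derangements of \<open>k\<close> points (\<open>deranged_bell_eq_sum\<close>). Derangements have the exponential generating
  function \<open>exp (- y) / (1 - y)\<close>, and partitions into \<open>k\<close> blocks have \<open>(exp x - 1) ^ k / k!\<close>.
  Substituting \<open>y = exp x - 1\<close> shows that \<open>deranged_bell n / n!\<close> is the \<open>n\<close>-th Taylor coefficient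
  of \<open>exp (1 - exp x) / (2 - exp x)\<close> (\<open>deranged_bell_egf\<close>).

  This function is meromorphic in the plane, with poles only where \<open>exp z = 2\<close>, that is at
  \<open>ln 2 + 2 * m * pi * \<i>\<close> for integers \<open>m\<close>. The pole at \<open>ln 2\<close> is simple with principal part
  \<open>(1 / (2 * e)) / (ln 2 - z)\<close>, whose coefficients are the main term. The next poles have modulus
  \<open>sqrt (ln 2 ^ 2 + 4 * pi ^ 2)\<close>, slightly more than \<open>6.3213\<close> (\<open>second_pole_bound\<close>), so after
  subtracting the principal part the Taylor series converges on a disc of radius larger than \<open>6.3213\<close>,
  and its coefficients are \<open>O(6.3213 ^ (- n))\<close> (\<open>fps_coeff_simple_pole_bigo\<close>).
\<close>

section \<open>Set partitions and Stirling numbers\<close>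

text \<open>
  Taking out the block \<open>C\<close> of a new point \<open>a\<close> leaves a partition of the rest. Putting \<open>C - {a}\<close> back,
  unless it is empty, inverts the insertion of \<open>a\<close> into a partition of \<open>A\<close>.
\<close>
lemma partition_on_split_block_of:
  assumes "partition_on (insert a A) Q" and "a \<notin> A"
  obtains C where "C \<in> Q" "a \<in> C" "partition_on (A - (C - {a})) (Q - {C})"
proof -
  from partition_onD1[OF assms(1)] obtain C where C: "C \<in> Q" "a \<in> C"
    by auto
  have dis: "disjnt C (\<Union>(Q - {C}))"
    using partition_onD2[OF assms(1)] C by (auto simp: disjnt_iff pairwise_def)
  have "partition_on (insert a A) (insert C (Q - {C}))"
    using assms(1) C by (simp add: insert_absorb)
  then have "partition_on (insert a A - C) (Q - {C})"
    using partition_on_insert[OF dis] by blast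
  moreover have "insert a A - C = A - (C - {a})"
    using C assms(2) by auto
  ultimately have "partition_on (A - (C - {a})) (Q - {C})"
    by simp
  with C show thesis
    by (rule that)
qed

text \<open>
  The Stirling recurrence records where a new point \<open>a\<close> goes: either \<open>{a}\<close> is a block of its own
  on top of a partition with one block less, or \<open>a\<close> joins one of the \<open>k\<close> blocks of a partition
  with \<open>k\<close> blocks. In the second case the partition and the block can be read off again from the
  unique block that contains \<open>a\<close>.
\<close>
lemma card_partitions_with_card:
  assumes "finite A"
  shows "card {P. partition_on A P \<and> card P = k} = Stirling (card A) k"
  using assms
proof (induction A arbitrary: k rule: finite_induct)
  case empty
  have eq: "{P. partition_on ({} :: 'a set) P \<and> card P = k} = (if k = 0 then {{}} else {})"
    by (auto simp: partition_on_empty)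
  show ?case
    unfolding eq by (cases k) simp_all
next
  case (insert a A)
  define X where "X k = {P. partition_on A P \<and> card P = k}" for k
  define Y where "Y k = {P. partition_on (insert a A) P \<and> card P = k}" for k
  have finX: "finite (X k)" for k
    using finitely_many_partition_on[OF insert.hyps(1)] by (auto simp: X_def)
  have finP: "finite P" if "P \<in> X k" for P k
    using that finite_elements[OF insert.hyps(1)] by (auto simp: X_def)
  have notin: "a \<notin> B" if "P \<in> X k" "B \<in> P" for P k B
    using that partition_onD1[of A P] insert.hyps(2) by (auto simp: X_def)
  show ?case
  proof (cases k)
    case 0
    have "P = {}" if "partition_on (insert a A) P" "card P = 0" for P
      using that finite_elements[of "insert a A" P] insert.hyps(1) by auto
    then have "Y 0 = {}"
      using partition_onD1 by (fastforce simp: Y_def)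
    then show ?thesis
      using 0 insert.hyps by (simp flip: Y_def)
  next
    case (Suc j)
    define f where "f = (\<lambda>(P, B). insert (insert a B) (P - {B}))"
    define S where "S = (SIGMA P:X k. P)"
    have f_in: "f (P, B) \<in> Y k" if "P \<in> X k" "B \<in> P" for P B
    proof -
      have dis: "disjnt B (\<Union>(P - {B}))"
        using that partition_onD2[of A P] by (auto simp: X_def disjnt_iff pairwise_def)
      have "partition_on A (insert B (P - {B}))"
        using that by (simp add: X_def insert_absorb)
      then have *: "partition_on (A - B) (P - {B})" "B \<subseteq> A" "B \<noteq> {}"
        using partition_on_insert[OF dis] by blast+
      have aP: "a \<notin> \<Union>P"
        using notin that by auto
      have "disjnt (insert a B) (\<Union>(P - {B}))"
        using dis aP by (auto simp: disjnt_iff)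
      moreover have "insert a A - insert a B = A - B"
        using insert.hyps(2) by auto
      ultimately have "partition_on (insert a A) (f (P, B))"
        using * by (auto simp: f_def partition_on_insert)
      moreover have "insert a B \<notin> P"
        using aP by auto
      then have "card (f (P, B)) = card P"
        using finP[OF that(1)] that(2) by (simp add: f_def card_Suc_Diff1 del: card_Diff_insert)
      ultimately show ?thesis
        using that by (simp add: X_def Y_def)
    qed
    (* In a partition of the form f (P, B), the block D containing a is insert a B. Removing a
       from D recovers B, and putting B in place of D recovers P. *)
    have inj_f: "inj_on f S"
    proof (rule inj_onI, clarsimp simp: S_def, goal_cases)
      case (1 P B P' B')
      have B: "B = D - {a}" "P = insert B (f (P, B) - {D})"
        if "D \<in> f (P, B)" "a \<in> D" "P \<in> X k" "B \<in> P" for P B D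
      proof -
        have "D = insert a B"
          using that notin[of P k] by (auto simp: f_def)
        moreover have "insert a B \<notin> P" "a \<notin> B"
          using that notin[of P k] by auto
        ultimately show "B = D - {a}" "P = insert B (f (P, B) - {D})"
          using that by (auto simp: f_def)
      qed
      have D: "insert a B \<in> f (P, B)"
        by (simp add: f_def)
      with 1 have D': "insert a B \<in> f (P', B')"
        by simp
      have "B = B'"
        using B(1)[OF D] B(1)[OF D'] 1 by simp
      moreover have "P = P'"
        using B(2)[OF D] B(2)[OF D'] 1 \<open>B = B'\<close> by simp
      ultimately show ?case
        by simp
    qed
    have Y_eq: "Y k = insert {a} ` X j \<union> f ` S"
    proof (intro equalityI subsetI)
      fix Q assume "Q \<in> Y k"
      then have Q: "partition_on (insert a A) Q" "card Q = Suc j"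
        using Suc by (auto simp: Y_def)
      have finQ: "finite Q"
        using Q(2) by (intro card_ge_0_finite) simp
      obtain C where C: "C \<in> Q" "a \<in> C" "partition_on (A - (C - {a})) (Q - {C})"
        using partition_on_split_block_of[OF Q(1) insert.hyps(2)] by blast
      show "Q \<in> insert {a} ` X j \<union> f ` S"
      proof (cases "C = {a}")
        case True
        then have "Q - {C} \<in> X j"
          using C(1,3) Q(2) finQ by (simp add: X_def)
        then have "insert {a} (Q - {C}) \<in> insert {a} ` X j"
          by blast
        then show ?thesis
          using True C(1) by (simp add: insert_absorb)
      next
        case False
        define B where "B = C - {a}"
        define P where "P = insert B (Q - {C})"
        have UQ: "\<Union>(Q - {C}) = A - B"
          using partition_onD1[OF C(3)] unfolding B_def by (rule sym)
        have BA: "B \<subseteq> A" "B \<noteq> {}"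
          using partition_onD1[OF Q(1)] C(1,2) False unfolding B_def by blast+
        have "disjnt B (\<Union>(Q - {C}))"
          unfolding UQ by (auto simp: disjnt_iff)
        then have "partition_on A P"
          using C(3) BA by (simp add: P_def partition_on_insert B_def)
        moreover have "B \<notin> Q - {C}"
          using UQ BA by auto
        then have "card P = Suc j"
          using finQ Q(2) C(1) by (simp add: P_def)
        ultimately have "(P, B) \<in> S"
          using Suc by (simp add: S_def X_def P_def)
        moreover have "f (P, B) = Q"
          using \<open>B \<notin> Q - {C}\<close> C(1,2) by (auto simp: f_def P_def B_def insert_absorb)
        ultimately have "Q \<in> f ` S"
          by (metis imageI)
        then show ?thesis
          by (rule UnI2)
      qed
    next
      fix Q assume "Q \<in> insert {a} ` X j \<union> f ` S"
      then show "Q \<in> Y k"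
      proof
        assume "Q \<in> f ` S"
        then show ?thesis
          using f_in by (auto simp: S_def)
      next
        assume "Q \<in> insert {a} ` X j"
        then obtain P where P: "P \<in> X j" "Q = insert {a} P"
          by blast
        have "disjnt {a} (\<Union>P)" "{a} \<notin> P"
          using notin[OF P(1)] by (auto simp: disjnt_iff)
        then show ?thesis
          using P finP[OF P(1)] insert.hyps(2) Suc
          by (simp add: Y_def X_def partition_on_insert)
      qed
    qed
    have "insert {a} ` X j \<inter> f ` S = {}"
    proof -
      have "{a} \<notin> f (P, B)" if "P \<in> X k" "B \<in> P" for P B
        using that notin[OF that(1)] partition_onD3[of A P]
        by (auto simp: f_def X_def subset_singleton_iff)
      then show ?thesis
        unfolding S_def by blast
    qed
    moreover have "inj_on (insert {a}) (X j)"
    proof (rule inj_onI)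
      fix P P' assume *: "P \<in> X j" "P' \<in> X j" "insert {a} P = insert {a} P'"
      have "{a} \<notin> P" "{a} \<notin> P'"
        using notin[OF *(1)] notin[OF *(2)] by auto
      with *(3) show "P = P'"
        by (simp add: insert_ident)
    qed
    moreover have "finite S"
      unfolding S_def by (intro finite_SigmaI finX finP[of _ k])
    ultimately have "card (Y k) = card (X j) + card S"
      using inj_f finX[of j] unfolding Y_eq by (simp add: card_Un_disjoint card_image)
    also have "card S = (\<Sum>P\<in>X k. card P)"
      unfolding S_def by (intro card_SigmaI finX ballI finP[of _ k])
    also have "\<dots> = k * card (X k)"
      by (simp add: X_def)
    finally show ?thesis
      using insert.hyps by (simp add: Suc Y_def X_def insert.IH)
  qed
qed

section \<open>Derangements\<close>

definition subfactorial :: "nat \<Rightarrow> nat" where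
  "subfactorial n = card {\<pi>. \<pi> permutes {..<n} \<and> (\<forall>x\<in>{..<n}. \<pi> x \<noteq> x)}"

lemma card_derangements:
  assumes "finite A"
  shows "card {\<pi>. \<pi> permutes A \<and> (\<forall>x\<in>A. \<pi> x \<noteq> x)} = subfactorial (card A)"
proof -
  obtain h where "bij_betw h {..<card A} A"
    using ex_bij_betw_nat_finite[OF assms] by (auto simp: atLeast0LessThan)
  from bij_betw_same_card[OF bij_betw_derangements[OF this]] show ?thesis
    by (simp add: subfactorial_def)
qed

text \<open>
  Every permutation is a derangement of exactly one set, the set of its moved points; hence the
  permutations are classified by that set, and only its size matters for the count.
\<close>
lemma fact_eq_sum_subfactorial:
  "fact n = (\<Sum>k\<le>n. (n choose k) * subfactorial k)"
proof -
  define Der where "Der T = {\<pi>. \<pi> permutes T \<and> (\<forall>x\<in>T. \<pi> x \<noteq> x)}" for T :: "nat set"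
  have moved: "T = {x. \<pi> x \<noteq> x}" if "\<pi> \<in> Der T" for \<pi> T
    using that by (auto simp: Der_def permutes_def)
  have "{\<pi>. \<pi> permutes {..<n}} = (\<Union>T\<in>Pow {..<n}. Der T)"
  proof (intro equalityI subsetI)
    fix \<pi> assume "\<pi> \<in> {\<pi>. \<pi> permutes {..<n}}"
    then have "{x. \<pi> x \<noteq> x} \<in> Pow {..<n}" "\<pi> \<in> Der {x. \<pi> x \<noteq> x}"
      by (auto simp: Der_def permutes_def)
    then show "\<pi> \<in> (\<Union>T\<in>Pow {..<n}. Der T)"
      by blast
  qed (auto simp: Der_def intro: permutes_subset)
  then have "fact n = card (\<Union>T\<in>Pow {..<n}. Der T)"
    using card_permutations[of "{..<n}" n] by simp
  also have "\<dots> = (\<Sum>T\<in>Pow {..<n}. card (Der T))"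
  proof (rule card_UN_disjoint)
    show "\<forall>T\<in>Pow {..<n}. finite (Der T)"
    proof
      fix T assume "T \<in> Pow {..<n}"
      then have "finite {\<pi>. \<pi> permutes T}"
        by (intro finite_permutations) (auto dest: finite_subset)
      then show "finite (Der T)"
        by (simp add: Der_def)
    qed
    show "\<forall>T\<in>Pow {..<n}. \<forall>T'\<in>Pow {..<n}. T \<noteq> T' \<longrightarrow> Der T \<inter> Der T' = {}"
      using moved by blast
  qed simp
  also have "\<dots> = (\<Sum>T\<in>Pow {..<n}. subfactorial (card T))"
    by (intro sum.cong) (auto simp: Der_def card_derangements dest: finite_subset)
  also have "\<dots> = (\<Sum>k\<le>n. \<Sum>T\<in>{T \<in> Pow {..<n}. card T = k}. subfactorial (card T))"
    by (rule sum.group[symmetric]) (auto dest: card_mono[rotated])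
  also have "\<dots> = (\<Sum>k\<le>n. (n choose k) * subfactorial k)"
    by (intro sum.cong) (simp_all add: n_subsets[of "{..<n}", simplified])
  finally show ?thesis .
qed

section \<open>Deranged partitions\<close>

lemma inj_on_Min_partition:
  fixes P :: "'a :: linorder set set"
  assumes "partition_on A P" and "finite A"
  shows "inj_on Min P" and "Min ` P \<subseteq> A"
proof -
  have Min: "Min B \<in> B" if "B \<in> P" for B
  proof (rule Min_in)
    show "finite B"
      using that assms partition_onD1[OF assms(1)] by (metis Union_upper finite_subset)
    show "B \<noteq> {}"
      using that partition_onD3[OF assms(1)] by auto
  qed
  then show "inj_on Min P"
    using partition_onD2[OF assms(1)] by (intro inj_onI) (metis disjnt_iff pairwiseD)
  show "Min ` P \<subseteq> A"
    using Min partition_onD1[OF assms(1)] by auto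
qed

lemma standard_partition_iff_strict_sorted_Min:
  "standard_partition n Bs \<longleftrightarrow>
     partition_on {1..n} (set Bs) \<and> sorted_wrt (<) (map Min Bs)"
  by (simp add: standard_partition_def sorted_wrt_map)

lemma standard_partition_distinct:
  "standard_partition n Bs \<Longrightarrow> distinct Bs"
  by (auto simp: standard_partition_iff_strict_sorted_Min strict_sorted_iff distinct_map)

text \<open>
  Distinct blocks have distinct minima, so listing the blocks by increasing minimum is possible in
  exactly one way. Counting standard lists is thus counting set partitions.
\<close>
lemma bij_betw_set_standard_partition:
  "bij_betw set {Bs. standard_partition n Bs} {P. partition_on {1..n} P}"
proof (rule bij_betwI')
  fix Bs Cs
  assume Bs: "Bs \<in> {Bs. standard_partition n Bs}" and Cs: "Cs \<in> {Bs. standard_partition n Bs}"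
  show "(set Bs = set Cs) = (Bs = Cs)"
  proof
    assume eq: "set Bs = set Cs"
    then have "map Min Bs = map Min Cs"
      using Bs Cs by (intro strict_sorted_equal) (auto simp: standard_partition_iff_strict_sorted_Min)
    moreover have "inj_on Min (set Bs \<union> set Cs)"
      using inj_on_Min_partition(1)[of "{1..n}" "set Bs"] Bs eq
      by (simp add: standard_partition_def)
    ultimately show "Bs = Cs"
      by (simp add: inj_on_map_eq_map)
  qed simp
next
  fix P assume "P \<in> {P. partition_on {1..n} P}"
  then have P: "partition_on {1..n} P" by simp
  obtain xs where xs: "set xs = P" "distinct xs"
    using finite_distinct_list finite_elements[OF _ P] by blast
  have "distinct (map Min (sort_key Min xs))"
    using xs inj_on_Min_partition(1)[OF P] by (simp add: distinct_map)
  then have "sorted_wrt (<) (map Min (sort_key Min xs))" "set (sort_key Min xs) = P"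
    using xs by (simp_all add: strict_sorted_iff)
  then show "\<exists>Bs\<in>{Bs. standard_partition n Bs}. P = set Bs"
    using P by (intro bexI[of _ "sort_key Min xs"]) (simp_all add: standard_partition_iff_strict_sorted_Min)
qed (auto simp: standard_partition_def)

text \<open>
  A deranged partition determines both the partition it comes from (its set of blocks) and, the
  blocks being distinct, the permutation. A partition with \<open>k\<close> blocks therefore contributes the
  number of derangements of \<open>k\<close> points.
\<close>
lemma deranged_bell_eq_sum:
  "deranged_bell n = (\<Sum>k\<le>n. Stirling n k * subfactorial k)"
proof -
  define Std where "Std = {Bs. standard_partition n Bs}"
  define Part where "Part = {P. partition_on {1..n} P}"
  define Der where "Der k = {\<sigma>. \<sigma> permutes {..<k} \<and> (\<forall>i\<in>{..<k}. \<sigma> i \<noteq> i)}" for k :: nat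
  have bij: "bij_betw set Std Part"
    unfolding Std_def Part_def by (rule bij_betw_set_standard_partition)
  have finPart: "finite Part"
    by (simp add: Part_def finitely_many_partition_on)
  have finStd: "finite Std"
    using bij_betw_finite[OF bij] finPart by simp
  have dist: "distinct Bs" if "Bs \<in> Std" for Bs
    using that standard_partition_distinct by (auto simp: Std_def)
  have finDer: "finite (Der k)" for k
    using finite_permutations[of "{..<k}"] by (simp add: Der_def)
  have der_iff: "(\<forall>i<length Bs. Bs ! \<sigma> i \<noteq> Bs ! i) \<longleftrightarrow> (\<forall>i\<in>{..<length Bs}. \<sigma> i \<noteq> i)"
    if "Bs \<in> Std" "\<sigma> permutes {..<length Bs}" for Bs \<sigma>
    using dist[OF that(1)] permutes_in_image[OF that(2)] by (auto simp: nth_eq_iff_index_eq)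
  have "deranged_partitions n =
      (\<lambda>(Bs, \<sigma>). permute_list \<sigma> Bs) ` (SIGMA Bs:Std. Der (length Bs))"
    (is "_ = ?g ` ?S")
  proof (intro equalityI subsetI)
    fix x assume "x \<in> deranged_partitions n"
    then obtain \<sigma> Bs where "x = permute_list \<sigma> Bs" "Bs \<in> Std" "\<sigma> permutes {..<length Bs}"
      "\<forall>i<length Bs. Bs ! \<sigma> i \<noteq> Bs ! i"
      by (auto simp: deranged_partitions_def Std_def)
    then have "x = ?g (Bs, \<sigma>)" "(Bs, \<sigma>) \<in> ?S"
      using der_iff[of Bs \<sigma>] by (auto simp: Der_def)
    then show "x \<in> ?g ` ?S"
      by (rule image_eqI)
  next
    fix x assume "x \<in> ?g ` ?S"
    then obtain \<sigma> Bs where "x = permute_list \<sigma> Bs" "Bs \<in> Std" "\<sigma> permutes {..<length Bs}"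
      "\<forall>i\<in>{..<length Bs}. \<sigma> i \<noteq> i"
      by (auto simp: Der_def)
    then show "x \<in> deranged_partitions n"
      using der_iff[of Bs \<sigma>] by (auto simp: deranged_partitions_def Std_def)
  qed
  moreover have "inj_on ?g ?S"
  proof (rule inj_onI, clarify, goal_cases)
    case (1 Bs \<sigma> Cs \<tau>)
    then have perm: "\<sigma> permutes {..<length Bs}" "\<tau> permutes {..<length Cs}"
      by (auto simp: Der_def)
    then have "set Bs = set Cs"
      using 1 by (metis set_permute_list)
    then have eq: "Bs = Cs"
      using bij 1 by (auto simp: bij_betw_def dest: inj_onD)
    have "\<sigma> i = \<tau> i" for i
    proof (cases "i < length Bs")
      case True
      then have "Bs ! \<sigma> i = Bs ! \<tau> i"
        using permute_list_nth[OF perm(1), of i] permute_list_nth[OF perm(2), of i] 1 eq by simp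
      then show ?thesis
        using True dist[of Bs] 1 perm permutes_in_image[OF perm(1), of i]
          permutes_in_image[OF perm(2), of i] eq by (simp add: nth_eq_iff_index_eq)
    next
      case False
      then show ?thesis
        using perm eq by (simp add: permutes_not_in)
    qed
    with eq show ?case by auto
  qed
  ultimately have "deranged_bell n = card ?S"
    by (simp add: deranged_bell_def card_image)
  also have "\<dots> = (\<Sum>Bs\<in>Std. card (Der (length Bs)))"
    using finStd finDer by simp
  also have "\<dots> = (\<Sum>Bs\<in>Std. subfactorial (card (set Bs)))"
    by (intro sum.cong) (simp_all add: Der_def subfactorial_def distinct_card dist)
  also have "\<dots> = (\<Sum>P\<in>Part. subfactorial (card P))"
    by (rule sum.reindex_bij_betw[OF bij])
  also have "\<dots> = (\<Sum>k\<le>n. \<Sum>P\<in>{P\<in>Part. card P = k}. subfactorial (card P))"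
  proof (rule sum.group[symmetric])
    have "card P \<le> n" if "P \<in> Part" for P
      using card_inj_on_le[OF inj_on_Min_partition[of "{1..n}" P]] that by (simp add: Part_def)
    then show "card ` Part \<subseteq> {..n}" by auto
  qed (use finPart in auto)
  also have "\<dots> = (\<Sum>k\<le>n. Stirling n k * subfactorial k)"
    using card_partitions_with_card[of "{1..n}"] by (intro sum.cong) (simp_all add: Part_def)
  finally show ?thesis .
qed

section \<open>Exponential generating functions\<close>

text \<open>
  The classification of permutations by their moved points is a binomial convolution; it says that
  the generating function becomes \<open>1 / (1 - X)\<close> after multiplication by \<open>exp X\<close>.
\<close>
lemma subfactorial_egf:
  "Abs_fps (\<lambda>n. of_nat (subfactorial n) / fact n :: 'a :: field_char_0) =
     fps_exp (-1) * inverse (1 - fps_X)"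
proof -
  let ?D = "Abs_fps (\<lambda>n. of_nat (subfactorial n) / fact n :: 'a)"
  have "?D * fps_exp 1 = Abs_fps (\<lambda>_. 1)"
  proof (rule fps_ext)
    fix n
    have "fps_nth (?D * fps_exp 1) n =
        (\<Sum>k\<le>n. of_nat (subfactorial k) / fact k * (1 / fact (n - k)))"
      by (simp add: fps_mult_nth atLeast0AtMost)
    also have "\<dots> = (\<Sum>k\<le>n. of_nat ((n choose k) * subfactorial k)) / fact n"
      by (auto simp: sum_divide_distrib binomial_fact intro!: sum.cong)
    also have "\<dots> = of_nat (fact n) / fact n"
      unfolding fact_eq_sum_subfactorial[of n] by (simp only: of_nat_sum)
    finally show "fps_nth (?D * fps_exp 1) n = fps_nth (Abs_fps (\<lambda>_. 1)) n"
      by simp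
  qed
  also have "Abs_fps (\<lambda>_. 1) = inverse (1 - fps_X :: 'a fps)"
    by (simp add: fps_inverse_one_minus_fps_X)
  finally have "fps_exp (-1) * (?D * fps_exp 1) = fps_exp (-1) * inverse (1 - fps_X)"
    by simp
  moreover have "fps_exp (-1) * (?D * fps_exp 1) = ?D * (fps_exp (-1) * fps_exp (1::'a))"
    by (simp only: mult_ac)
  moreover have "fps_exp (-1) * fps_exp (1::'a) = 1"
    by (simp flip: fps_exp_add_mult)
  ultimately show ?thesis
    by simp
qed

text \<open>
  Writing \<open>G = exp X - 1\<close>, the derivative \<open>G' = G + 1\<close> turns into
  \<open>(G ^ (j + 1))' = (j + 1) * (G ^ (j + 1) + G ^ j)\<close>, which is the Stirling recurrence read off
  coefficientwise.
\<close>
lemma Stirling_egf: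
  "fps_nth ((fps_exp 1 - 1) ^ k) n = (fact k * of_nat (Stirling n k) / fact n :: 'a :: field_char_0)"
proof (induction n arbitrary: k)
  case 0
  show ?case
    by (cases k) (simp_all add: fps_power_zeroth)
next
  case (Suc n)
  show ?case
  proof (cases k)
    case 0
    then show ?thesis by simp
  next
    case (Suc j)
    let ?G = "fps_exp 1 - 1 :: 'a fps"
    have "of_nat (Suc n) * fps_nth (?G ^ Suc j) (Suc n) = fps_nth (fps_deriv (?G ^ Suc j)) n"
      by (simp only: fps_deriv_nth Suc_eq_plus1)
    also have "fps_deriv (?G ^ Suc j) = of_nat (Suc j) * (?G ^ Suc j + ?G ^ j)"
      unfolding fps_deriv_power' by (simp add: algebra_simps)
    also have "fps_nth \<dots> n = of_nat (Suc j) * (fps_nth (?G ^ Suc j) n + fps_nth (?G ^ j) n)"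
      by (simp only: fps_of_nat[symmetric] fps_mult_left_const_nth fps_add_nth)
    also have "\<dots> = fact (Suc j) * of_nat (Stirling (Suc n) (Suc j)) / fact n"
      by (simp only: Suc.IH) (simp add: field_simps)
    finally show ?thesis
      unfolding Suc by (simp add: field_simps del: of_nat_Suc Stirling.simps)
  qed
qed

text \<open>
  Since \<open>G = exp X - 1\<close> has no constant term, the sum over the number of blocks is the coefficient
  extraction from a composition of power series. The composite is \<open>exp (1 - exp X) / (2 - exp X)\<close>.
\<close>
lemma deranged_bell_egf:
  "Abs_fps (\<lambda>n. of_nat (deranged_bell n) / fact n :: 'a :: field_char_0) =
     (fps_exp (-1) * inverse (1 - fps_X)) oo (fps_exp 1 - 1)"
proof (rule fps_ext)
  fix n
  show "fps_nth (Abs_fps (\<lambda>n. of_nat (deranged_bell n) / fact n :: 'a)) n =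
      fps_nth ((fps_exp (-1) * inverse (1 - fps_X)) oo (fps_exp 1 - 1)) n"
    unfolding subfactorial_egf[symmetric]
    by (simp add: fps_compose_nth Stirling_egf deranged_bell_eq_sum sum_divide_distrib
        atLeast0AtMost mult_ac)
qed

section \<open>Coefficients of a function with one simple pole\<close>

text \<open>
  Subtracting the principal part \<open>q a / (a - z)\<close>, whose coefficients are \<open>q a / a ^ (n + 1)\<close>, removes
  the only singularity in the ball. The remaining power series converges beyond radius \<open>r\<close>, so its
  terms at \<open>r\<close> are bounded.
\<close>
lemma fps_coeff_simple_pole_bigo:
  fixes f q :: "complex \<Rightarrow> complex" and F :: "complex fps" and a :: complex and r R :: real
  assumes F: "f has_fps_expansion F"
    and q: "q holomorphic_on ball 0 R"
    and f: "\<And>z. z \<in> ball 0 R - {a} \<Longrightarrow> f z = q z / (a - z)"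
    and "a \<noteq> 0" "0 < r" "r < R"
  shows "(\<lambda>n. norm (fps_nth F n - q a / a ^ (n + 1))) \<in> O(\<lambda>n. r powr (- real n))"
proof -
  \<comment> \<open>the holomorphic extension of \<open>f z - q a / (a - z)\<close> across \<open>a\<close>\<close>
  define h where "h = (\<lambda>z. - (if z = a then deriv q a else (q z - q a) / (z - a)))"
  define G where "G = fps_const (q a) * inverse (fps_const a - fps_X)"
  have "h holomorphic_on ball 0 R"
    unfolding h_def by (intro holomorphic_intros pole_lemma_open q) auto
  moreover have "h has_fps_expansion F - G"
  proof -
    have "(\<lambda>z. q a * inverse (a - z)) has_fps_expansion G"
      unfolding G_def using \<open>a \<noteq> 0\<close> by (intro fps_expansion_intros) auto
    with F have "(\<lambda>z. f z - q a * inverse (a - z)) has_fps_expansion F - G"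
      by (intro fps_expansion_intros)
    moreover have "eventually (\<lambda>z. z \<in> ball 0 R - {a}) (nhds 0)"
      using assms by (intro eventually_nhds_in_open) (auto simp: open_delete)
    then have "eventually (\<lambda>z. f z - q a * inverse (a - z) = h z) (nhds 0)"
    proof eventually_elim
      case (elim z)
      then have "z \<noteq> a" by auto
      with f[OF elim] show ?case
        by (simp add: h_def field_simps)
    qed
    ultimately show ?thesis
      by (simp add: has_fps_expansion_cong)
  qed
  ultimately have "ereal R \<le> fps_conv_radius (F - G)"
    using holomorphic_on_imp_fps_conv_radius_ge[of h "F - G" "ereal R"] by simp
  then have "ereal (norm (of_real r :: complex)) < fps_conv_radius (F - G)"
    using \<open>0 < r\<close> \<open>r < R\<close> by (intro order.strict_trans2[OF _ \<open>ereal R \<le> _\<close>]) simp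
  then have "summable (\<lambda>n. fps_nth (F - G) n * of_real r ^ n)"
    by (rule summable_fps)
  then obtain B where B: "norm (fps_nth (F - G) n * of_real r ^ n) \<le> B" for n
    using summable_imp_Bseq unfolding Bseq_def by blast
  have G_nth: "fps_nth G n = q a / a ^ (n + 1)" for n
  proof -
    let ?S = "Abs_fps (\<lambda>n. q a / a ^ (n + 1))"
    have "?S * (fps_const a - fps_X) = fps_const (q a)"
    proof (rule fps_ext)
      fix n
      have "fps_nth (?S * (fps_const a - fps_X)) n =
          fps_nth ?S n * a - (if n = 0 then 0 else fps_nth ?S (n - 1))"
        by (simp only: right_diff_distrib fps_sub_nth fps_mult_right_const_nth fps_X_mult_right_nth)
      also have "\<dots> = fps_nth (fps_const (q a)) n"
        using \<open>a \<noteq> 0\<close> by (cases n) simp_all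
      finally show "fps_nth (?S * (fps_const a - fps_X)) n = fps_nth (fps_const (q a)) n" .
    qed
    then have "?S * ((fps_const a - fps_X) * inverse (fps_const a - fps_X)) = G"
      unfolding G_def by (simp only: mult.assoc[symmetric])
    moreover have "(fps_const a - fps_X) * inverse (fps_const a - fps_X) = 1"
      using \<open>a \<noteq> 0\<close> by (intro inverse_mult_eq_1') simp
    ultimately show ?thesis
      by auto
  qed
  show ?thesis
  proof (rule bigoI[where c = B], rule always_eventually, rule allI)
    fix n
    have "norm (fps_nth F n - q a / a ^ (n + 1)) * r ^ n \<le> B"
      using B[of n] \<open>0 < r\<close> by (simp add: G_nth norm_mult norm_power)
    then show "norm (norm (fps_nth F n - q a / a ^ (n + 1))) \<le> B * norm (r powr (- real n))"
      using \<open>0 < r\<close> by (simp add: powr_minus powr_realpow field_simps)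
  qed
qed

section \<open>The poles of the generating function\<close>

lemma exp_complex_ln_2: "exp (of_real (ln 2) :: complex) = 2"
  by (subst exp_of_real) simp

text \<open>
  The bound is tight: \<open>ln 2 ^ 2 + 4 * pi ^ 2\<close> exceeds \<open>6.3213 ^ 2\<close> by less than \<open>4 / 10 ^ 5\<close>, which
  dictates the number of digits needed for \<open>ln 2\<close> and \<open>pi\<close>.
\<close>
lemma second_pole_bound: "6.3213 < cmod (Complex (ln 2) (2 * pi))"
proof (rule power2_less_imp_less)
  have "ln 2 \<in> {0.69314..(0.6932::real)}"
    using ln_approx_bounds[of 2 5] by (simp add: eval_nat_numeral)
  then have "(0.69314::real)\<^sup>2 \<le> (ln 2)\<^sup>2"
    by (intro power_mono) auto
  moreover have "(3.141592::real)\<^sup>2 \<le> pi\<^sup>2"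
    using pi_approx(1) by (intro power_mono) auto
  ultimately show "(6.3213)\<^sup>2 < (cmod (Complex (ln 2) (2 * pi)))\<^sup>2"
    unfolding cmod_power2 by (simp add: power_mult_distrib power2_eq_square)
qed auto

text \<open>
  The solutions of \<open>exp z = 2\<close> are \<open>ln 2 + 2 * n * pi * \<i>\<close>, and those with \<open>n \<noteq> 0\<close> have at least
  the modulus of the one with \<open>n = 1\<close>.
\<close>
lemma exp_eq_2_imp_eq_ln_2:
  assumes "exp z = 2" "cmod z < cmod (Complex (ln 2) (2 * pi))"
  shows "z = of_real (ln 2)"
proof -
  have "exp z = exp (of_real (ln 2))"
    using assms(1) exp_complex_ln_2 by simp
  then obtain n :: int where n: "z = of_real (ln 2) + of_int (2 * n) * pi * \<i>"
    unfolding exp_eq by auto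
  have "n = 0"
  proof (rule ccontr)
    assume "n \<noteq> 0"
    then have "1 \<le> \<bar>real_of_int n\<bar>" by linarith
    then have "(2 * pi)\<^sup>2 \<le> (2 * real_of_int n * pi)\<^sup>2"
      by (subst abs_le_square_iff[symmetric]) (simp add: abs_mult)
    then have "(cmod (Complex (ln 2) (2 * pi)))\<^sup>2 \<le> (cmod z)\<^sup>2"
      unfolding cmod_power2 by (simp add: n)
    with assms(2) show False
      by (smt (verit) norm_ge_zero power_mono_iff power2_le_imp_le)
  qed
  with n show ?thesis by simp
qed

text \<open>
  This is the numerator \<open>q\<close> in \<open>exp (1 - exp z) / (2 - exp z) = q z / (ln 2 - z)\<close>. Its denominator
  is the divided difference of \<open>exp\<close> at \<open>ln 2\<close>, which is entire once it takes the value
  \<open>exp (ln 2) = 2\<close> of the derivative at \<open>ln 2\<close>. A zero of it solves \<open>exp z = 2\<close> and differs from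
  \<open>ln 2\<close>, so no zero lies in the ball.
\<close>
lemma deranged_bell_numerator_holomorphic:
  defines "q \<equiv> (\<lambda>z::complex. exp (1 - exp z) /
             (if z = of_real (ln 2) then 2 else (exp z - 2) / (z - of_real (ln 2))))"
  shows "q holomorphic_on ball 0 (cmod (Complex (ln 2) (2 * pi)))"
proof -
  let ?a = "of_real (ln 2) :: complex"
  have e: "exp ?a = 2" by (rule exp_complex_ln_2)
  have d: "deriv exp ?a = 2" using e by (simp add: DERIV_imp_deriv[OF DERIV_exp])
  have "(\<lambda>z. if z = ?a then 2 else (exp z - 2) / (z - ?a)) holomorphic_on UNIV"
    using pole_lemma_open[of exp UNIV ?a] unfolding e d by (simp add: holomorphic_on_exp)
  then have "(\<lambda>z. if z = ?a then 2 else (exp z - 2) / (z - ?a)) holomorphic_on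
      ball 0 (cmod (Complex (ln 2) (2 * pi)))"
    by (rule holomorphic_on_subset) auto
  then show ?thesis unfolding q_def
    using exp_eq_2_imp_eq_ln_2 by (intro holomorphic_intros) (auto split: if_splits)
qed

section \<open>Asymptotics of the deranged Bell numbers\<close>

theorem theorem5p1:
  "(\<lambda>n. real (deranged_bell n) / fact n - 1 / (2 * exp 1 * ln 2 ^ (n + 1)))
     \<in> O(\<lambda>n. (6.3213 :: real) powr (- real n))"
proof -
  define a :: complex where "a = of_real (ln 2)"
  define q :: "complex \<Rightarrow> complex" where
    "q = (\<lambda>z. exp (1 - exp z) / (if z = a then 2 else (exp z - 2) / (z - a)))"
  \<comment> \<open>The factors \<open>-1\<close> and \<open>1\<close> give the exponentials the shape \<open>exp (c * x)\<close> of \<open>fps_exp c\<close>.\<close>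
  define f :: "complex \<Rightarrow> complex" where
    "f = (\<lambda>w. exp (-1 * w) * inverse (1 - w)) \<circ> (\<lambda>z. exp (1 * z) - 1)"
  define F :: "complex fps" where "F = Abs_fps (\<lambda>n. of_nat (deranged_bell n) / fact n)"
  let ?R = "cmod (Complex (ln 2) (2 * pi))"
  have "f has_fps_expansion ((fps_exp (-1) * inverse (1 - fps_X)) oo (fps_exp 1 - 1))"
    unfolding f_def by (intro fps_expansion_intros) auto
  then have F: "f has_fps_expansion F"
    by (simp add: F_def deranged_bell_egf)
  have q: "q holomorphic_on ball 0 ?R"
    unfolding q_def a_def by (rule deranged_bell_numerator_holomorphic)
  have f: "f z = q z / (a - z)" if "z \<in> ball 0 ?R - {a}" for z
  proof -
    have "exp z \<noteq> 2"
      using that exp_eq_2_imp_eq_ln_2[of z] by (auto simp: a_def)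
    moreover have "z \<noteq> a"
      using that by simp
    moreover have "f z = exp (1 - exp z) / (2 - exp z)"
      by (simp add: f_def divide_inverse algebra_simps)
    ultimately show ?thesis
      by (simp add: q_def divide_simps) (simp add: algebra_simps)
  qed
  have qa: "q a = of_real (1 / (2 * exp 1))"
  proof -
    have "exp a = 2"
      unfolding a_def by (rule exp_complex_ln_2)
    then have "q a = inverse (exp 1) / 2"
      by (simp add: q_def exp_minus)
    also have "\<dots> = inverse (of_real (exp 1)) / 2"
      by (simp flip: exp_of_real)
    also have "\<dots> = of_real (1 / (2 * exp 1))"
      by (simp add: field_simps del: exp_of_real)
    finally show ?thesis .
  qed
  have "a \<noteq> 0"
    by (simp add: a_def)
  with fps_coeff_simple_pole_bigo[OF F q f _ _ second_pole_bound]
  have "(\<lambda>n. norm (fps_nth F n - q a / a ^ (n + 1))) \<in> O(\<lambda>n. 6.3213 powr (- real n))"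
    by simp
  moreover have "fps_nth F n - q a / a ^ (n + 1) =
      of_real (real (deranged_bell n) / fact n - 1 / (2 * exp 1 * ln 2 ^ (n + 1)))" for n
    unfolding qa by (simp add: F_def a_def)
  then have "norm (fps_nth F n - q a / a ^ (n + 1)) =
      \<bar>real (deranged_bell n) / fact n - 1 / (2 * exp 1 * ln 2 ^ (n + 1))\<bar>" for n
    by (simp only: norm_of_real)
  ultimately show ?thesis
    by (simp only: landau_o.big.abs_in_iff)
qed

end
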